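(* Let $X$ be a bounded ultrametric space and let $Y$ be a complete $Q$-Ahlfors regular metric space. If $$\dim_{\mathrm A}X<Q,$$ then $X$ admits a bi-Lipschitz embedding into $Y$.
   Context: An ultrametric space is a metric space with $d(x,z)\le\max\{d(x,y),d(y,z)\}$ for all $x,y,z$. For a metric space $X$, $E\subseteq X$ and $r>0$, $N_X(E,r)$ denotes the smallest number of balls of radius $r$ required to cover $E$ ($\infty$ if no finite cover exists). The Assouad dimension $\dim_{\mathrm A}X$ is the infimum of all $s\ge 0$ for which there exists $C\ge 1$ such that $N_X(B_X(x,R),r)\le C(R/r)^s$ for every $x\in X$ and $0<r<R$. For $Q>0$, a metric space $Y$ is $Q$-Ahlfors regular if there exist a Borel measure $\mu$ on $Y$ and a constant $C\ge 1$ such that $C^{-1}r^Q\le\mu(B_Y(y,r))\le Cr^Q$ for every $y\in Y$ and every $0<r\le\operatorname{diam}(Y)$ (for every $r>0$ if $Y$ is unbounded). A map $f:X\to Y$ is a bi-Lipschitz embedding if there are constants $k,K>0$ with $\frac1k d_X(x,y)\le d_Y(f(x),f(y))\le K d_X(x,y)$ for all $x,y\in X$.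
   Formalization: The formal statement assumes that Y has at least two points; a one-point Y is vacuously Q-Ahlfors regular under the given definition, and a two-point X (Assouad dimension 0) does not embed into it. *)

theory Defs
  imports "HOL-Analysis.Analysis"
begin

text \<open>
  A metric space is a subset \<open>X\<close> of a type of class \<^class>\<open>metric_space\<close>, carrying the
  restricted distance; the whole type is the case \<open>X = UNIV\<close>. All balls are open balls of the
  space \<open>X\<close> itself, i.e. \<open>ball x r \<inter> X\<close> with centre \<open>x \<in> X\<close>.
\<close>

definition ultrametric_on :: "'a::metric_space set \<Rightarrow> bool" where
  "ultrametric_on X \<longleftrightarrow>
     (\<forall>x\<in>X. \<forall>y\<in>X. \<forall>z\<in>X. dist x z \<le> max (dist x y) (dist y z))"

text \<open>If no finite cover exists, the infimum over the empty set is \<open>\<infinity>\<close>.\<close>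

definition covering_number :: "'a::metric_space set \<Rightarrow> 'a set \<Rightarrow> real \<Rightarrow> enat" where
  "covering_number X E r =
     Inf {enat (card \<B>) |\<B>. finite \<B> \<and> \<B> \<subseteq> (\<lambda>x. ball x r \<inter> X) ` X \<and> E \<subseteq> \<Union>\<B>}"

text \<open>If no exponent \<open>s\<close> is admissible, the dimension is \<open>\<infinity>\<close>.\<close>

definition assouad_dim :: "'a::metric_space set \<Rightarrow> ereal" where
  "assouad_dim X =
     Inf {ereal s |s. 0 \<le> s \<and>
       (\<exists>C::real\<ge>1. \<forall>x\<in>X. \<forall>r R. 0 < r \<and> r < R \<longrightarrow>
          ereal_of_enat (covering_number X (ball x R \<inter> X) r) \<le> ereal (C * (R / r) powr s))}"

text \<open>
  \<open>sets (restrict_space borel Y)\<close> is the Borel sigma-algebra of the subspace \<open>Y\<close>.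
  The condition on the radii is vacuous if \<open>Y\<close> is empty or a single point, so such a \<open>Y\<close>
  satisfies the definition for every \<open>Q\<close>.
\<close>

definition ahlfors_regular :: "real \<Rightarrow> 'a::metric_space set \<Rightarrow> bool" where
  "ahlfors_regular Q Y \<longleftrightarrow>
     (\<exists>\<mu> :: 'a measure. sets \<mu> = sets (restrict_space borel Y) \<and>
       (\<exists>C::real\<ge>1. \<forall>y\<in>Y. \<forall>r. 0 < r \<and> (bounded Y \<longrightarrow> r \<le> diameter Y) \<longrightarrow>
          ennreal (r powr Q / C) \<le> emeasure \<mu> (ball y r \<inter> Y) \<and>
          emeasure \<mu> (ball y r \<inter> Y) \<le> ennreal (C * r powr Q)))"

definition bilipschitz_embedding ::
    "'a::metric_space set \<Rightarrow> 'b::metric_space set \<Rightarrow> ('a \<Rightarrow> 'b) \<Rightarrow> bool" where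
  "bilipschitz_embedding X Y f \<longleftrightarrow>
     f ` X \<subseteq> Y \<and>
     (\<exists>k K :: real. 0 < k \<and> 0 < K \<and>
       (\<forall>x\<in>X. \<forall>x'\<in>X. 1 / k * dist x x' \<le> dist (f x) (f x') \<and>
          dist (f x) (f x') \<le> K * dist x x'))"

end

theory Submission
  imports Defs
begin

text \<open>
  In an ultrametric space the relation \<open>dist x x' < t\<close> is an equivalence relation, and its
  classes are exactly the open balls of radius \<open>t\<close>. Fix a ratio \<open>l\<close> and a number \<open>D\<close> larger than
  all distances in \<open>X\<close>. The balls of radius \<open>D * l ^ n\<close> then form a tree in \<open>n\<close>: each ball of level
  \<open>n\<close> is partitioned by balls of level \<open>n + 1\<close>. A bound with exponent \<open>s\<close> on covering numbers says
  that each node has at most \<open>C * (1/l) powr s\<close> children, because a covering of a node by balls of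
  the next level must list every child.

  On the other side, comparing volumes shows that a ball of radius \<open>R\<close> in the regular space \<open>Y\<close>
  contains, up to a constant factor, \<open>(R/r) powr Q\<close> points at mutual distance at least \<open>r\<close>. Since \<open>s < Q\<close>, a small
  ratio \<open>l\<close> makes the number of such points for \<open>r = 8 * l * R\<close> at least as large as the number of
  children. So the tree can be drawn in \<open>Y\<close> from the root down: a node of level \<open>n\<close> sits at a point,
  and its children are sent to distinct, well separated points within \<open>R = d * l ^ n\<close> of it.
  The positions along a branch form a Cauchy sequence, and the limit is the image of the point of
  \<open>X\<close> that determines the branch. If two points of \<open>X\<close> separate between the levels \<open>n\<close> and
  \<open>n + 1\<close>, then their distance is comparable to \<open>l ^ n\<close>; their images lie within \<open>4 * d * l ^ n\<close>
  because the branches agree up to level \<open>n\<close>, and they stay \<open>4 * d * l ^ (n + 1)\<close> apart because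
  the later steps of the two branches together use up at most half of the separation
  \<open>8 * d * l ^ (n + 1)\<close> created at level \<open>n + 1\<close>.

  The tree is encoded by labels: \<open>ultrametric_child_labels\<close> numbers the children of every node,
  \<open>ahlfors_regular_separated_points\<close> provides the positions for the numbers, and
  \<open>exists_branching_ratio\<close> matches the two counts.
\<close>

section \<open>Balls in ultrametric spaces\<close>

lemma ultrametric_on_dist_less_trans:
  assumes "ultrametric_on X" "x \<in> X" "y \<in> X" "z \<in> X" "dist x y < r" "dist y z < r"
  shows "dist x z < r"
proof -
  have "dist x z \<le> max (dist x y) (dist y z)"
    using assms(1-4) unfolding ultrametric_on_def by blast
  with assms(5,6) show ?thesis by linarith
qed

lemma ultrametric_on_ball_eq:
  assumes "ultrametric_on X" "x \<in> X" "y \<in> X" "dist x y < r"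
  shows "ball x r \<inter> X = ball y r \<inter> X"
proof (intro set_eqI iffI)
  fix z assume "z \<in> ball x r \<inter> X"
  then show "z \<in> ball y r \<inter> X"
    using ultrametric_on_dist_less_trans[of X y x z r] assms by (auto simp: dist_commute)
next
  fix z assume "z \<in> ball y r \<inter> X"
  then show "z \<in> ball x r \<inter> X"
    using ultrametric_on_dist_less_trans[of X x y z r] assms by auto
qed

lemma assouad_dim_less_imp_cover:
  assumes "assouad_dim X < ereal Q"
  obtains s C where "s < Q" "1 \<le> C"
    "\<And>x r R. x \<in> X \<Longrightarrow> 0 < r \<Longrightarrow> r < R \<Longrightarrow>
       \<exists>\<B>. finite \<B> \<and> \<B> \<subseteq> (\<lambda>x. ball x r \<inter> X) ` X \<and> ball x R \<inter> X \<subseteq> \<Union>\<B> \<and>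
         real (card \<B>) \<le> C * (R / r) powr s"
proof -
  obtain s C where "s < Q" and C: "1 \<le> C" and
    bound: "\<And>x r R. x \<in> X \<Longrightarrow> 0 < r \<and> r < R \<Longrightarrow>
      ereal_of_enat (covering_number X (ball x R \<inter> X) r) \<le> ereal (C * (R / r) powr s)"
    using assms unfolding assouad_dim_def Inf_less_iff by auto
  show ?thesis
  proof (rule that[OF \<open>s < Q\<close> C])
    fix x r R assume x: "x \<in> X" and r: "0 < r" "r < (R::real)"
    define S where "S = {enat (card \<B>) |\<B>. finite \<B> \<and> \<B> \<subseteq> (\<lambda>x. ball x r \<inter> X) ` X \<and>
      ball x R \<inter> X \<subseteq> \<Union>\<B>}"
    have le: "ereal_of_enat (Inf S) \<le> ereal (C * (R / r) powr s)"
      using bound[of x r R] x r unfolding covering_number_def S_def by simp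
    have "S \<noteq> {}"
    proof
      assume "S = {}"
      then have "Inf S = \<infinity>" by (simp add: top_enat_def)
      with le show False by simp
    qed
    then have "Inf S \<in> S"
      using wellorder_InfI by blast
    then obtain \<B> where \<B>: "Inf S = enat (card \<B>)" "finite \<B>"
        "\<B> \<subseteq> (\<lambda>x. ball x r \<inter> X) ` X" "ball x R \<inter> X \<subseteq> \<Union>\<B>"
      unfolding S_def by blast
    with le show "\<exists>\<B>. finite \<B> \<and> \<B> \<subseteq> (\<lambda>x. ball x r \<inter> X) ` X \<and> ball x R \<inter> X \<subseteq> \<Union>\<B> \<and>
         real (card \<B>) \<le> C * (R / r) powr s"
      by auto
  qed
qed

text \<open>
  Distinct balls of radius \<open>r\<close> are disjoint, so every ball of radius \<open>r\<close> with centre in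
  \<open>ball x R\<close> is a member of any family of \<open>r\<close>-balls covering \<open>ball x R\<close>. Hence a covering of size
  at most \<open>M\<close> leaves at most \<open>M\<close> such balls in all, and these can be numbered. The label \<open>c x\<close> is
  the number of the \<open>r\<close>-ball of \<open>x\<close> within the \<open>R\<close>-ball of \<open>x\<close>.
\<close>

lemma ultrametric_child_labels:
  fixes X :: "'a::metric_space set"
  assumes ultra: "ultrametric_on X" and r: "0 < r" "r < R"
    and cover: "\<And>x. x \<in> X \<Longrightarrow> \<exists>\<B>. finite \<B> \<and> \<B> \<subseteq> (\<lambda>x. ball x r \<inter> X) ` X \<and>
       ball x R \<inter> X \<subseteq> \<Union>\<B> \<and> card \<B> \<le> M"
  obtains c :: "'a \<Rightarrow> nat" where "\<And>x. x \<in> X \<Longrightarrow> c x < M"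
    "\<And>x y. x \<in> X \<Longrightarrow> y \<in> X \<Longrightarrow> dist x y < r \<Longrightarrow> c x = c y"
    "\<And>x y. x \<in> X \<Longrightarrow> y \<in> X \<Longrightarrow> dist x y < R \<Longrightarrow> c x = c y \<Longrightarrow> dist x y < r"
proof -
  define B where "B t x = ball x t \<inter> X" for t x
  have "\<exists>h::'a set \<Rightarrow> nat. inj_on h (B r ` E) \<and> h ` B r ` E \<subseteq> {..<M}" if "E \<in> B R ` X" for E
  proof -
    obtain x where x: "x \<in> X" "E = B R x" using \<open>E \<in> B R ` X\<close> by blast
    obtain \<B> where \<B>: "finite \<B>" "\<B> \<subseteq> B r ` X" "B R x \<subseteq> \<Union>\<B>" "card \<B> \<le> M"
      using cover[OF x(1)] unfolding B_def by blast
    have sub: "B r ` E \<subseteq> \<B>"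
    proof
      fix b assume "b \<in> B r ` E"
      then obtain y where y: "y \<in> B R x" "b = B r y" using x by blast
      then obtain e where "e \<in> \<B>" "y \<in> e" using \<B>(3) by blast
      moreover from this obtain z where "z \<in> X" "e = B r z" using \<B>(2) by blast
      ultimately have z: "z \<in> X" "B r z \<in> \<B>" "y \<in> B r z" by simp_all
      have "B r z = B r y"
        using ultrametric_on_ball_eq[OF ultra, of z y r] y z unfolding B_def by simp
      with y z show "b \<in> \<B>" by simp
    qed
    then have fin: "finite (B r ` E)" and "card (B r ` E) \<le> M"
      using \<B> card_mono[of \<B> "B r ` E"] finite_subset by auto
    then show ?thesis
      using card_le_inj[OF fin, of "{..<M}"] by auto
  qed
  then obtain h :: "'a set \<Rightarrow> 'a set \<Rightarrow> nat"
    where h: "\<And>E. E \<in> B R ` X \<Longrightarrow> inj_on (h E) (B r ` E)"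
      "\<And>E. E \<in> B R ` X \<Longrightarrow> h E ` B r ` E \<subseteq> {..<M}"
    by metis
  show ?thesis
  proof (rule that[of "\<lambda>x. h (B R x) (B r x)"])
    fix x assume x: "x \<in> X"
    then have "x \<in> B R x" using r by (simp add: B_def)
    then show "h (B R x) (B r x) < M" using h(2)[of "B R x"] x by blast
  next
    fix x y assume "x \<in> X" "y \<in> X" "dist x y < r"
    then show "h (B R x) (B r x) = h (B R y) (B r y)"
      using ultrametric_on_ball_eq[OF ultra, of x y] r unfolding B_def by simp
  next
    fix x y assume xy: "x \<in> X" "y \<in> X" "dist x y < R"
      and eq: "h (B R x) (B r x) = h (B R y) (B r y)"
    have E: "B R x = B R y"
      using ultrametric_on_ball_eq[OF ultra] xy unfolding B_def by blast
    have "x \<in> B R x" "y \<in> B R x" using xy r by (auto simp: B_def)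
    then have "B r x = B r y"
      using inj_onD[OF h(1)[of "B R x"], of "B r x" "B r y"] eq E xy by auto
    moreover have "y \<in> B r y" using xy r by (simp add: B_def)
    ultimately have "y \<in> B r x" by simp
    then show "dist x y < r" by (simp add: B_def)
  qed
qed

section \<open>Separated points in Ahlfors regular spaces\<close>

text \<open>
  The points are chosen greedily. As long as there are fewer than \<open>(R/r) powr Q / A\<close> of them, the
  \<open>r\<close>-balls around them have too small a total measure to cover the \<open>R\<close>-ball, and any uncovered
  point can be added. Each of the two inequalities in the definition of regularity costs one factor
  of the regularity constant, so its square serves as \<open>A\<close>.
\<close>

lemma ahlfors_regular_separated_points:
  fixes Y :: "'b::metric_space set"
  assumes "ahlfors_regular Q Y"
  obtains A :: real where "1 \<le> A"
    "\<And>y r R M. y \<in> Y \<Longrightarrow> 0 < r \<Longrightarrow> r \<le> R \<Longrightarrow> (bounded Y \<longrightarrow> R \<le> diameter Y) \<Longrightarrow>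
       real M \<le> (R / r) powr Q / A \<Longrightarrow>
       \<exists>p::nat \<Rightarrow> 'b. (\<forall>i<M. p i \<in> ball y R \<inter> Y) \<and> (\<forall>i<M. \<forall>j<M. i \<noteq> j \<longrightarrow> r \<le> dist (p i) (p j))"
proof -
  obtain \<mu> :: "'b measure" and C :: real where
    sets: "sets \<mu> = sets (restrict_space borel Y)" and C: "1 \<le> C" and
    lower: "\<And>y r. y \<in> Y \<Longrightarrow> 0 < r \<Longrightarrow> (bounded Y \<Longrightarrow> r \<le> diameter Y) \<Longrightarrow>
      ennreal (r powr Q / C) \<le> emeasure \<mu> (ball y r \<inter> Y)" and
    upper: "\<And>y r. y \<in> Y \<Longrightarrow> 0 < r \<Longrightarrow> (bounded Y \<Longrightarrow> r \<le> diameter Y) \<Longrightarrow>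
      emeasure \<mu> (ball y r \<inter> Y) \<le> ennreal (C * r powr Q)"
    using assms unfolding ahlfors_regular_def by blast
  have meas: "ball y r \<inter> Y \<in> sets \<mu>" for y r
    unfolding sets sets_restrict_space by (auto simp: Int_commute)
  show ?thesis
  proof (rule that[of "C * C"])
    show "1 \<le> C * C" using mult_mono[OF C C] C by simp
  next
    fix y r R M
    assume y: "y \<in> Y" and r: "0 < r" "r \<le> (R::real)" and R: "bounded Y \<longrightarrow> R \<le> diameter Y"
      and "real M \<le> (R / r) powr Q / (C * C)"
    from this(5) show "\<exists>p::nat \<Rightarrow> 'b. (\<forall>i<M. p i \<in> ball y R \<inter> Y) \<and>
      (\<forall>i<M. \<forall>j<M. i \<noteq> j \<longrightarrow> r \<le> dist (p i) (p j))"
    proof (induction M)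
      case 0
      show ?case by simp
    next
      case (Suc M)
      then obtain p :: "nat \<Rightarrow> 'b" where p: "\<And>i. i < M \<Longrightarrow> p i \<in> ball y R \<inter> Y"
        "\<And>i j. i < M \<Longrightarrow> j < M \<Longrightarrow> i \<noteq> j \<Longrightarrow> r \<le> dist (p i) (p j)"
        by auto
      have "\<not> ball y R \<inter> Y \<subseteq> (\<Union>i<M. ball (p i) r \<inter> Y)"
      proof
        assume "ball y R \<inter> Y \<subseteq> (\<Union>i<M. ball (p i) r \<inter> Y)"
        then have "emeasure \<mu> (ball y R \<inter> Y) \<le> emeasure \<mu> (\<Union>i<M. ball (p i) r \<inter> Y)"
          by (rule emeasure_mono) (intro sets.finite_UN finite_lessThan meas)
        also have "\<dots> \<le> (\<Sum>i<M. emeasure \<mu> (ball (p i) r \<inter> Y))"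
          by (rule emeasure_subadditive_finite) (use meas in auto)
        also have "\<dots> \<le> (\<Sum>i<M. ennreal (C * r powr Q))"
          by (intro sum_mono upper) (use p r R in force)+
        also have "\<dots> = ennreal (real M * (C * r powr Q))"
          using C by (simp add: ennreal_mult ennreal_of_nat_eq_real_of_nat)
        finally have "ennreal (R powr Q / C) \<le> ennreal (real M * (C * r powr Q))"
          using lower[OF y, of R] r R by (meson order_trans less_le_trans)
        then have "R powr Q / C \<le> real M * (C * r powr Q)"
          using C by (subst (asm) ennreal_le_iff) auto
        then have "(R / r) powr Q / (C * C) \<le> real M"
          using C r by (simp add: powr_divide field_simps)
        with Suc.prems show False by simp
      qed
      then obtain z where z: "z \<in> ball y R \<inter> Y" "\<And>i. i < M \<Longrightarrow> r \<le> dist (p i) z"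
        by force
      show ?case
        by (rule exI[of _ "p(M := z)"]) (use p z in \<open>auto simp: less_Suc_eq dist_commute\<close>)
    qed
  qed
qed

section \<open>Choice of the ratio and passage to the limit\<close>

text \<open>
  The claimed inequality amounts to \<open>l powr (Q - s) \<le> 1 / (C * A * 8 powr Q)\<close>, and the left side
  is arbitrarily small because \<open>Q - s\<close> is positive.
\<close>

lemma exists_branching_ratio:
  fixes s Q A C :: real
  assumes "s < Q" "1 \<le> A" "1 \<le> C"
  obtains l where "0 < l" "l \<le> 1 / 8" "C * (1 / l) powr s \<le> (1 / (8 * l)) powr Q / A"
proof -
  define K where "K = C * A * 8 powr Q"
  define l where "l = min (1 / 8) (K powr (- 1 / (Q - s)))"
  have K: "0 < K" using assms by (simp add: K_def)
  then have l: "0 < l" "l \<le> 1 / 8" by (auto simp: l_def)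
  have "l powr (Q - s) \<le> (K powr (- 1 / (Q - s))) powr (Q - s)"
    by (rule powr_mono2) (use assms l in \<open>auto simp: l_def\<close>)
  also have "\<dots> = K powr (- 1)"
    using assms by (simp only: powr_powr) simp
  also have "\<dots> = 1 / K"
    using K by (simp add: powr_minus_divide)
  finally have "K * l powr (Q - s) \<le> 1"
    using K by (simp add: field_simps)
  then have "K * l powr Q \<le> l powr s"
    using l by (simp add: powr_diff field_simps)
  then have "C * (1 / l) powr s \<le> (1 / (8 * l)) powr Q / A"
    using l assms unfolding K_def by (simp add: powr_divide powr_mult field_simps)
  with l show ?thesis by (rule that)
qed

text \<open>
  The total length of the steps from \<open>n\<close> on is at most \<open>d * l ^ n / (1 - l)\<close>, and
  \<open>1 / (1 - l) \<le> 2\<close>. The estimate of the finite part of this sum by \<open>2 * d * (l ^ n - l ^ (n + k))\<close>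
  has the telescoping form in which it passes through an induction on \<open>k\<close>.
\<close>

lemma geometric_steps_converge:
  fixes u :: "nat \<Rightarrow> 'b::metric_space"
  assumes "complete Y" "\<And>n. u n \<in> Y" "0 < d" "0 < l" "l \<le> 1 / 2"
    and step: "\<And>n. dist (u n) (u (Suc n)) \<le> d * l ^ n"
  obtains y where "y \<in> Y" "\<And>n. dist (u n) y \<le> 2 * d * l ^ n"
proof -
  have tele: "dist (u n) (u (n + k)) \<le> 2 * d * (l ^ n - l ^ (n + k))" for n k
  proof (induction k)
    case 0
    show ?case by simp
  next
    case (Suc k)
    have "d * l ^ (n + k) * l \<le> d * l ^ (n + k) * (1 / 2)"
      using assms by (intro mult_left_mono) auto
    then have "d * l ^ (n + k) \<le> 2 * d * (l ^ (n + k) - l ^ (n + Suc k))"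
      by (simp add: algebra_simps)
    with step[of "n + k"] Suc.IH dist_triangle[of "u n" "u (n + Suc k)" "u (n + k)"]
    show ?case by (simp add: algebra_simps)
  qed
  have bound: "dist (u n) (u m) \<le> 2 * d * l ^ n" if "n \<le> m" for n m
  proof -
    have "0 \<le> 2 * d * l ^ m" using assms by simp
    with tele[of n "m - n"] that show ?thesis by (simp add: algebra_simps)
  qed
  have lim0: "(\<lambda>n. 2 * d * l ^ n) \<longlonglongrightarrow> 0"
    by (intro tendsto_mult_right_zero LIMSEQ_realpow_zero) (use assms in auto)
  have "Cauchy u"
  proof (rule metric_CauchyI)
    fix e :: real assume "0 < e"
    then obtain N where N: "2 * d * l ^ N < e / 2"
      using order_tendstoD(2)[OF lim0, of "e / 2"] by (auto simp: eventually_sequentially)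
    have "dist (u m) (u n) < e" if "N \<le> m" "N \<le> n" for m n
      using bound[OF that(1)] bound[OF that(2)] N dist_triangle3[of "u m" "u n" "u N"] by linarith
    then show "\<exists>N. \<forall>m\<ge>N. \<forall>n\<ge>N. dist (u m) (u n) < e" by blast
  qed
  then obtain y where y: "y \<in> Y" "u \<longlonglongrightarrow> y"
    using assms(1,2) unfolding complete_def by blast
  have "dist (u n) y \<le> 2 * d * l ^ n" for n
  proof (rule LIMSEQ_le_const2)
    show "(\<lambda>m. dist (u n) (u m)) \<longlonglongrightarrow> dist (u n) y"
      by (intro tendsto_intros y)
    show "\<exists>N. \<forall>m\<ge>N. dist (u n) (u m) \<le> 2 * d * l ^ n" using bound by blast
  qed
  with y show ?thesis by (intro that)
qed

lemma exists_geometric_level: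
  fixes t D l :: real
  assumes "0 < t" "t < D" "0 < l" "l < 1"
  obtains n where "D * l ^ Suc n \<le> t" "t < D * l ^ n"
proof -
  have "\<exists>n. D * l ^ n \<le> t"
  proof -
    obtain n where "l ^ n < t / D"
      using real_arch_pow_inv[of "t / D" l] assms by auto
    then show ?thesis using assms by (auto simp: field_simps intro!: exI[of _ n])
  qed
  then obtain n where n: "D * l ^ n \<le> t" "\<And>m. m < n \<Longrightarrow> \<not> D * l ^ m \<le> t"
    using exists_least_iff[of "\<lambda>n. D * l ^ n \<le> t"] by blast
  with assms(2) obtain k where "n = Suc k" by (cases n) auto
  with n(1) n(2)[of k] show ?thesis by (intro that[of k]) auto
qed

text \<open>
  The construction in the tree. A branch is described by its sequence of labels \<open>c n x\<close>, and
  \<open>p n y i\<close> is the position of the child with label \<open>i\<close> of a node of level \<open>n\<close> that sits at \<open>y\<close>.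
  Positions therefore depend on the labels alone, so that branches which agree up to a level
  automatically have the same position there.
\<close>

lemma bilipschitz_embedding_of_labels:
  fixes X :: "'a::metric_space set" and Y :: "'b::metric_space set"
  assumes "complete Y" "y0 \<in> Y" and d: "0 < d" and D: "0 < D" and l: "0 < l" "l \<le> 1 / 8"
    and diam: "\<And>x x'. x \<in> X \<Longrightarrow> x' \<in> X \<Longrightarrow> dist x x' < D"
    and c_less: "\<And>n x. x \<in> X \<Longrightarrow> c n x < (M::nat)"
    and c_eq: "\<And>n x x'. x \<in> X \<Longrightarrow> x' \<in> X \<Longrightarrow> dist x x' < D * l ^ Suc n \<Longrightarrow> c n x = c n x'"
    and c_inj: "\<And>n x x'. x \<in> X \<Longrightarrow> x' \<in> X \<Longrightarrow> dist x x' < D * l ^ n \<Longrightarrow> c n x = c n x' \<Longrightarrow>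
      dist x x' < D * l ^ Suc n"
    and p_in: "\<And>n y i. y \<in> Y \<Longrightarrow> i < M \<Longrightarrow> p n y i \<in> ball y (d * l ^ n) \<inter> Y"
    and p_sep: "\<And>n y i j. y \<in> Y \<Longrightarrow> i < M \<Longrightarrow> j < M \<Longrightarrow> i \<noteq> j \<Longrightarrow>
      8 * d * l ^ Suc n \<le> dist (p n y i) (p n y j)"
  shows "\<exists>f. bilipschitz_embedding X Y f"
proof -
  define g where "g x = rec_nat y0 (\<lambda>n y. p n y (c n x))" for x
  have g0: "g x 0 = y0" and gS: "g x (Suc n) = p n (g x n) (c n x)" for x n
    by (simp_all add: g_def)
  have gY: "g x n \<in> Y" if "x \<in> X" for x n
    by (induction n) (use that g0 gS c_less p_in assms(2) in auto)
  have gstep: "dist (g x n) (g x (Suc n)) \<le> d * l ^ n" if "x \<in> X" for x n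
    using p_in[OF gY[OF that] c_less[OF that], of n n n] by (simp add: gS)
  have gcong: "g x n = g x' n" if "x \<in> X" "x' \<in> X" "dist x x' < D * l ^ n" for x x' n
    using that(3)
  proof (induction n)
    case 0
    show ?case by (simp add: g0)
  next
    case (Suc n)
    have "D * l ^ Suc n \<le> D * l ^ n" using l D by (simp add: mult_left_le_one_le)
    with Suc have "g x n = g x' n" by simp
    with c_eq[OF that(1,2) Suc.prems] show ?case by (simp add: gS)
  qed
  have "\<exists>y. y \<in> Y \<and> (\<forall>n. dist (g x n) y \<le> 2 * d * l ^ n)" if "x \<in> X" for x
    by (rule geometric_steps_converge[OF assms(1) gY[OF that] d l(1) _ gstep[OF that]])
      (use l in auto)
  then obtain f where fY: "\<And>x. x \<in> X \<Longrightarrow> f x \<in> Y"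
    and fg: "\<And>x n. x \<in> X \<Longrightarrow> dist (g x n) (f x) \<le> 2 * d * l ^ n"
    by metis
  have "(4 * d * l / D) * dist x x' \<le> dist (f x) (f x') \<and>
      dist (f x) (f x') \<le> (4 * d / (D * l)) * dist x x'" if x: "x \<in> X" "x' \<in> X" for x x'
  proof (cases "x = x'")
    case True
    then show ?thesis by simp
  next
    case False
    then obtain n where n: "D * l ^ Suc n \<le> dist x x'" "dist x x' < D * l ^ n"
      using exists_geometric_level[of "dist x x'" D l] diam[OF x] l by auto
    have eq: "g x n = g x' n" using gcong[OF x n(2)] .
    have "c n x \<noteq> c n x'" using c_inj[OF x n(2)] n(1) by linarith
    then have "8 * d * l ^ Suc n \<le> dist (g x (Suc n)) (g x' (Suc n))"
      unfolding gS eq using p_sep gY c_less x by blast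
    also have "\<dots> \<le> dist (g x (Suc n)) (f x) + dist (f x) (f x') + dist (g x' (Suc n)) (f x')"
      using dist_triangle[of "g x (Suc n)" "g x' (Suc n)" "f x"]
        dist_triangle[of "f x" "g x' (Suc n)" "f x'"]
      by (simp add: dist_commute)
    finally have "4 * d * l ^ Suc n \<le> dist (f x) (f x')"
      using fg[OF x(1), of "Suc n"] fg[OF x(2), of "Suc n"] by linarith
    moreover have "(4 * d * l / D) * dist x x' \<le> (4 * d * l / D) * (D * l ^ n)"
      using n(2) d D l by (intro mult_left_mono) auto
    moreover have "(4 * d * l / D) * (D * l ^ n) = 4 * d * l ^ Suc n"
      using D by (simp add: field_simps)
    moreover have "dist (f x) (f x') \<le> 4 * d * l ^ n"
      using fg[OF x(1), of n] fg[OF x(2), of n] dist_triangle3[of "f x" "f x'" "g x n"]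
      by (simp add: eq)
    moreover have "4 * d * l ^ n = (4 * d / (D * l)) * (D * l ^ Suc n)"
      using D l by (simp add: field_simps)
    moreover have "(4 * d / (D * l)) * (D * l ^ Suc n) \<le> (4 * d / (D * l)) * dist x x'"
      using n(1) d D l by (intro mult_left_mono) auto
    ultimately show ?thesis by linarith
  qed
  moreover have "0 < D / (4 * d * l)" "0 < 4 * d / (D * l)" using d D l by simp_all
  ultimately have "bilipschitz_embedding X Y f"
    unfolding bilipschitz_embedding_def using fY
    by (intro conjI exI[of _ "D / (4 * d * l)"] exI[of _ "4 * d / (D * l)"]) auto
  then show ?thesis by blast
qed

section \<open>The embedding theorem\<close>

theorem corollary6p4:
  fixes X :: "'a::metric_space set" and Y :: "'b::metric_space set" and Q :: real
  assumes "bounded X" and "ultrametric_on X"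
    and "Q > 0" and "complete Y" and "ahlfors_regular Q Y"
    and "\<not> (\<exists>y. Y \<subseteq> {y})"
    and "assouad_dim X < ereal Q"
  shows "\<exists>f. bilipschitz_embedding X Y f"
proof -
  obtain s C where s: "s < Q" and C: "1 \<le> C" and
    cover: "\<And>x r R. x \<in> X \<Longrightarrow> 0 < r \<Longrightarrow> r < R \<Longrightarrow>
       \<exists>\<B>. finite \<B> \<and> \<B> \<subseteq> (\<lambda>x. ball x r \<inter> X) ` X \<and> ball x R \<inter> X \<subseteq> \<Union>\<B> \<and>
         real (card \<B>) \<le> C * (R / r) powr s"
    by (rule assouad_dim_less_imp_cover[OF assms(7)]) (rule that)
  obtain A where A: "1 \<le> A" and
    sep: "\<And>y r R M. y \<in> Y \<Longrightarrow> 0 < r \<Longrightarrow> r \<le> R \<Longrightarrow> (bounded Y \<longrightarrow> R \<le> diameter Y) \<Longrightarrow>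
       real M \<le> (R / r) powr Q / A \<Longrightarrow>
       \<exists>p::nat \<Rightarrow> 'b. (\<forall>i<M. p i \<in> ball y R \<inter> Y) \<and> (\<forall>i<M. \<forall>j<M. i \<noteq> j \<longrightarrow> r \<le> dist (p i) (p j))"
    by (rule ahlfors_regular_separated_points[OF assms(5)]) (rule that)
  obtain l where l: "0 < l" "l \<le> 1 / 8"
    and ratio: "C * (1 / l) powr s \<le> (1 / (8 * l)) powr Q / A"
    by (rule exists_branching_ratio[OF s A C])
  define M where "M = nat \<lfloor>C * (1 / l) powr s\<rfloor>"
  have M: "real M \<le> C * (1 / l) powr s"
    using C unfolding M_def by simp

  obtain e where "\<And>x x'. x \<in> X \<Longrightarrow> x' \<in> X \<Longrightarrow> dist x x' \<le> e"
    using assms(1) unfolding bounded_two_points by blast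
  then obtain D where D: "0 < D" and diam: "\<And>x x'. x \<in> X \<Longrightarrow> x' \<in> X \<Longrightarrow> dist x x' < D"
    by (intro that[of "max e 0 + 1"]) force+
  obtain y0 y1 where y: "y0 \<in> Y" "y1 \<in> Y" "y0 \<noteq> y1"
    using assms(6) by blast
  \<comment> \<open>Radii up to the distance of two points do not exceed the diameter of \<open>Y\<close>.\<close>
  define d where "d = dist y0 y1"
  have d: "0 < d" and d_diam: "bounded Y \<Longrightarrow> d \<le> diameter Y"
    using y diameter_bounded_bound unfolding d_def by auto

  have "\<exists>c::'a \<Rightarrow> nat. (\<forall>x\<in>X. c x < M) \<and>
      (\<forall>x\<in>X. \<forall>x'\<in>X. dist x x' < D * l ^ Suc n \<longrightarrow> c x = c x') \<and>
      (\<forall>x\<in>X. \<forall>x'\<in>X. dist x x' < D * l ^ n \<longrightarrow> c x = c x' \<longrightarrow> dist x x' < D * l ^ Suc n)" for n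
  proof -
    have r: "0 < D * l ^ Suc n" "D * l ^ Suc n < D * l ^ n"
      using D l by simp_all
    have "D * l ^ n / (D * l ^ Suc n) = 1 / l" using D l by simp
    then have "\<exists>\<B>. finite \<B> \<and> \<B> \<subseteq> (\<lambda>x. ball x (D * l ^ Suc n) \<inter> X) ` X \<and>
        ball x (D * l ^ n) \<inter> X \<subseteq> \<Union>\<B> \<and> card \<B> \<le> M" if "x \<in> X" for x
      using cover[OF that r] unfolding M_def by (auto simp: le_nat_floor)
    from ultrametric_child_labels[OF assms(2) r this] show ?thesis
      by metis
  qed
  then obtain c :: "nat \<Rightarrow> 'a \<Rightarrow> nat" where c: "\<And>n x. x \<in> X \<Longrightarrow> c n x < M"
    "\<And>n x x'. x \<in> X \<Longrightarrow> x' \<in> X \<Longrightarrow> dist x x' < D * l ^ Suc n \<Longrightarrow> c n x = c n x'"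
    "\<And>n x x'. x \<in> X \<Longrightarrow> x' \<in> X \<Longrightarrow> dist x x' < D * l ^ n \<Longrightarrow> c n x = c n x' \<Longrightarrow>
      dist x x' < D * l ^ Suc n"
    by metis

  define slots where "slots n y q \<longleftrightarrow> (\<forall>i<M. q i \<in> ball y (d * l ^ n) \<inter> Y) \<and>
      (\<forall>i<M. \<forall>j<M. i \<noteq> j \<longrightarrow> 8 * d * l ^ Suc n \<le> dist (q i) (q j))" for n y and q :: "nat \<Rightarrow> 'b"
  have "\<exists>q. slots n y q" if "y \<in> Y" for n y
    unfolding slots_def
  proof (rule sep[OF that])
    show "0 < 8 * d * l ^ Suc n" using d l by simp
    have "d * l ^ n * (8 * l) \<le> d * l ^ n * 1"
      using d l by (intro mult_left_mono) auto
    then show "8 * d * l ^ Suc n \<le> d * l ^ n" by (simp add: algebra_simps)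
    have "d * l ^ n \<le> d" using d l by (simp add: mult_left_le power_le_one)
    then show "bounded Y \<longrightarrow> d * l ^ n \<le> diameter Y" using d_diam by force
    have "d * l ^ n / (8 * d * l ^ Suc n) = 1 / (8 * l)" using d l by simp
    then show "real M \<le> (d * l ^ n / (8 * d * l ^ Suc n)) powr Q / A"
      using M ratio by simp
  qed
  moreover define p where "p n y = (SOME q. slots n y q)" for n y
  ultimately have "slots n y (p n y)" if "y \<in> Y" for n y
    using someI_ex[of "slots n y"] that by simp
  then have p: "\<And>n y i. y \<in> Y \<Longrightarrow> i < M \<Longrightarrow> p n y i \<in> ball y (d * l ^ n) \<inter> Y"
    "\<And>n y i j. y \<in> Y \<Longrightarrow> i < M \<Longrightarrow> j < M \<Longrightarrow> i \<noteq> j \<Longrightarrow>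
      8 * d * l ^ Suc n \<le> dist (p n y i) (p n y j)"
    unfolding slots_def by blast+
  show ?thesis
    by (rule bilipschitz_embedding_of_labels[OF assms(4) y(1) d D l diam c p])
qed

end
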